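(* Let $\mathcal{H}$ be a real Hilbert space and let $f:\mathcal{H}\to\left]-\infty,+\infty\right]$ be a proper function such that $\mathcal{X}=\{z\in\mathcal{H} : f(z)=\min_{x\in\mathcal{H}} f(x)\}$ is nonempty; put $f_*=\min_{x\in\mathcal{H}} f(x)$. Let $\{x_t\}_{t\in\mathbb{N}}\subset\mathcal{H}$ be modified Fejér monotone with respect to the target function $f$ and a sequence $\{(\eta_t,\xi_t)\}_{t\in\mathbb{N}}$ in $\mathbb{R}_+^2$, and suppose that $\{\eta_t\}_{t\in\mathbb{N}}$ is non-increasing. Let $T\in\mathbb{N}$, $T>1$. Then $$\eta_T\,(f(x_T)-f_* )\;\leq\;\frac{1}{T}\,d(x_1,\mathcal{X})^2+\sum_{t=1}^{T-1}\frac{1}{T-t}\,\xi_t+\xi_T .$$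
   Context: $\mathbb{R}_+$ is the set of non-negative reals. $d(x,S)=\inf_{x'\in S}\|x-x'\|$. $\operatorname{dom} f=\{x\in\mathcal{H}: f(x)<+\infty\}$; $f$ is proper if it never takes the value $-\infty$ and $\operatorname{dom} f\neq\emptyset$. No convexity of $f$ is assumed. Definition: a sequence $\{x_t\}_{t\in\mathbb{N}}\subset\mathcal{H}$ is modified Fejér monotone with respect to the target function $f$ and the sequence $\{(\eta_t,\xi_t)\}_{t\in\mathbb{N}}$ in $\mathbb{R}_+^2$ if for every $t\in\mathbb{N}$ and every $x\in\operatorname{dom} f$, $$\|x_{t+1}-x\|^2\leq\|x_t-x\|^2-\eta_t\,(f(x_t)-f(x))+\xi_t .$$ Convention: $0\cdot(+\infty)=0$. (When $\eta_t>0$ the inequality forces $x_t\in\operatorname{dom} f$.) *)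

theory Defs
  imports "HOL-Analysis.Analysis"
begin

definition effective_domain :: "('a \<Rightarrow> ereal) \<Rightarrow> 'a set" where
  "effective_domain f = {x. f x < \<infinity>}"

definition proper :: "('a \<Rightarrow> ereal) \<Rightarrow> bool" where
  "proper f \<longleftrightarrow> (\<forall>x. f x \<noteq> -\<infinity>) \<and> effective_domain f \<noteq> {}"

(* The infimum is the minimum of f exactly when it is attained, that is, when
   minimizers f is nonempty. *)
definition min_value :: "('a \<Rightarrow> ereal) \<Rightarrow> ereal" where
  "min_value f = (INF x. f x)"

definition minimizers :: "('a \<Rightarrow> ereal) \<Rightarrow> 'a set" where
  "minimizers f = {z. f z = min_value f}"

(* Sequences are indexed by t = 1, 2, 3, ...; the values at index 0 are irrelevant.
   Multiplication on ereal satisfies 0 * \<infinity> = 0, so for \<eta> t = 0 the middle term vanishes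
   even if f (x t) = \<infinity>, while for \<eta> t > 0 the inequality forces f (x t) < \<infinity>. *)
definition modified_fejer_monotone ::
    "('a::real_inner \<Rightarrow> ereal) \<Rightarrow> (nat \<Rightarrow> real) \<Rightarrow> (nat \<Rightarrow> real) \<Rightarrow> (nat \<Rightarrow> 'a) \<Rightarrow> bool" where
  "modified_fejer_monotone f \<eta> \<xi> x \<longleftrightarrow>
     (\<forall>t\<ge>1. \<forall>y\<in>effective_domain f.
        ereal ((norm (x (Suc t) - y))\<^sup>2)
          \<le> ereal ((norm (x t - y))\<^sup>2) - ereal (\<eta> t) * (f (x t) - f y) + ereal (\<xi> t))"

end

theory Submission
  imports Defs
begin

text \<open>
  Put \<open>v\<^sub>t = \<eta>\<^sub>t (f(x\<^sub>t) - f\<^sub>*)\<close>. Telescoping the Fejer inequality bounds the whole sum of the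
  \<open>v\<^sub>t\<close> by \<open>d(x\<^sub>1, X)\<^sup>2 + \<Sum>\<xi>\<^sub>t\<close>, hence their average; the task is to pass from the average to
  the last iterate, although \<open>f(x\<^sub>t)\<close> need not decrease.

  The reference point of the Fejer inequality may be any point of the domain, in particular an
  earlier iterate \<open>x\<^sub>s\<close>. Telescoped from \<open>s\<close> to \<open>T\<close>, this choice makes the initial distance vanish,
  and since \<open>\<eta>\<close> is non-increasing and \<open>f(x\<^sub>s) \<ge> f\<^sub>*\<close>, it yields
  \<open>\<Sum>\<^sub>s\<^sub><\<^sub>t\<^sub>\<le>\<^sub>T (v\<^sub>t - v\<^sub>s) \<le> \<Sum>\<^sub>s\<^sub>\<le>\<^sub>t\<^sub>\<le>\<^sub>T \<xi>\<^sub>t\<close> (lemma \<open>fejer_tail_sum_le_first_gap\<close>): on average, the later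
  gaps exceed \<open>v\<^sub>s\<close> by no more than the errors allow. So enlarging the averaging window \<open>{s+1..T}\<close> by
  its left neighbour \<open>s\<close> can lower the average of \<open>v - \<xi>\<close> by at most \<open>\<xi>\<^sub>s / (T - s)\<close>. Starting from
  the window \<open>{T}\<close>, whose average involves only the last iterate, and ending
  with \<open>{1..T}\<close> produces exactly the weights \<open>1 / (T - t)\<close> (lemma \<open>last_le_average\<close>).

  The values of \<open>f\<close> are handled through \<^const>\<open>real_of_ereal\<close>, which sends \<open>\<infinity>\<close> to \<open>0\<close>. This is
  harmless: \<open>f(x\<^sub>t) = \<infinity>\<close> forces \<open>\<eta>\<^sub>t = 0\<close>, and the value then enters only multiplied by \<open>0\<close>.
\<close>

text \<open>
  One step of the induction replaces the window \<open>{s+1..T}\<close>, of length \<open>n = T - s\<close>, by \<open>{s..T}\<close>.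
  With \<open>A\<close> the sum of \<open>v - \<xi>\<close> over the shorter window, the required
  \<open>A / n \<le> (A + v\<^sub>s - \<xi>\<^sub>s) / (n + 1) + \<xi>\<^sub>s / n\<close> becomes, after multiplication by \<open>n (n + 1)\<close>, precisely
  the hypothesis \<open>A \<le> n v\<^sub>s + \<xi>\<^sub>s\<close>.
\<close>
lemma last_le_average:
  fixes v \<xi> :: "nat \<Rightarrow> real"
  assumes "r \<le> T"
    and tail: "\<And>s. r \<le> s \<Longrightarrow> s < T \<Longrightarrow>
      (\<Sum>t=Suc s..T. v t) \<le> real (T - s) * v s + (\<Sum>t=s..T. \<xi> t)"
  shows "v T \<le> (\<Sum>t=r..T. v t - \<xi> t) / real (Suc T - r) + (\<Sum>t=r..<T. \<xi> t / real (T - t)) + \<xi> T"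
  using \<open>r \<le> T\<close>
proof (induction rule: inc_induct)
  case base
  show ?case by simp
next
  case (step s)
  define n where "n = real (T - s)"
  define A where "A = (\<Sum>t=Suc s..T. v t - \<xi> t)"
  have n: "n > 0" "real (Suc T - s) = n + 1" "real (Suc T - Suc s) = n"
    using step.hyps by (auto simp: n_def)
  have A: "(\<Sum>t=s..T. v t - \<xi> t) = v s - \<xi> s + A"
    using step.hyps by (simp add: A_def sum.atLeast_Suc_atMost)
  have "A \<le> n * v s + \<xi> s"
    using tail[of s] step.hyps
    by (simp add: A_def n_def sum_subtractf sum.atLeast_Suc_atMost[of s T \<xi>])
  then have "0 \<le> (n * v s + \<xi> s - A) / (n * (n + 1))"
    using n(1) by simp
  also have "\<dots> = (v s - \<xi> s + A) / (n + 1) + \<xi> s / n - A / n"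
    using n(1) by (simp add: divide_simps) (simp add: algebra_simps)
  finally have "A / n \<le> (v s - \<xi> s + A) / (n + 1) + \<xi> s / n" by simp
  moreover have "(\<Sum>t=s..<T. \<xi> t / real (T - t)) = \<xi> s / n + (\<Sum>t=Suc s..<T. \<xi> t / real (T - t))"
    using step.hyps by (simp add: n_def sum.atLeast_Suc_lessThan)
  ultimately show ?case
    using step.IH unfolding A n A_def[symmetric] by linarith
qed

lemma finite_on_effective_domain:
  assumes "proper f" "y \<in> effective_domain f"
  shows "ereal (real_of_ereal (f y)) = f y"
  using assms by (cases "f y") (auto simp: proper_def effective_domain_def)

lemma fejer_iterate_in_effective_domain:
  assumes "proper f" "modified_fejer_monotone f \<eta> \<xi> x" "t \<ge> 1" "\<eta> t > 0"
  shows "x t \<in> effective_domain f"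
proof (rule ccontr)
  assume "x t \<notin> effective_domain f"
  then have "f (x t) = \<infinity>"
    by (auto simp: effective_domain_def)
  moreover obtain y where y: "y \<in> effective_domain f"
    using assms(1) by (auto simp: proper_def)
  moreover have "ereal ((norm (x (Suc t) - y))\<^sup>2)
      \<le> ereal ((norm (x t - y))\<^sup>2) - ereal (\<eta> t) * (f (x t) - f y) + ereal (\<xi> t)"
    using assms(2,3) y by (auto simp: modified_fejer_monotone_def)
  ultimately show False
    using assms(4) finite_on_effective_domain[OF assms(1) y] by (cases "f y") auto
qed

lemma fejer_step_real:
  assumes "proper f" "modified_fejer_monotone f \<eta> \<xi> x" "t \<ge> 1" "\<eta> t \<ge> 0"
    and y: "y \<in> effective_domain f"
  shows "(norm (x (Suc t) - y))\<^sup>2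
    \<le> (norm (x t - y))\<^sup>2 - \<eta> t * (real_of_ereal (f (x t)) - real_of_ereal (f y)) + \<xi> t"
proof -
  have "ereal (\<eta> t) * (f (x t) - f y)
      = ereal (\<eta> t * (real_of_ereal (f (x t)) - real_of_ereal (f y)))"
  proof (cases "\<eta> t = 0")
    case False
    then have "x t \<in> effective_domain f"
      using fejer_iterate_in_effective_domain assms by force
    from finite_on_effective_domain[OF assms(1) this] finite_on_effective_domain[OF assms(1) y]
    show ?thesis
      by (metis ereal_minus(1) times_ereal.simps(1))
  qed (simp add: zero_ereal_def[symmetric])
  moreover have "ereal ((norm (x (Suc t) - y))\<^sup>2)
      \<le> ereal ((norm (x t - y))\<^sup>2) - ereal (\<eta> t) * (f (x t) - f y) + ereal (\<xi> t)"
    using assms(2,3) y by (auto simp: modified_fejer_monotone_def)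
  ultimately show ?thesis by simp
qed

lemma fejer_telescope:
  assumes "proper f" "modified_fejer_monotone f \<eta> \<xi> x"
    and "\<And>t. t \<ge> 1 \<Longrightarrow> \<eta> t \<ge> 0"
    and y: "y \<in> effective_domain f" and "1 \<le> s" "s \<le> T"
  shows "(\<Sum>t=s..T. \<eta> t * (real_of_ereal (f (x t)) - real_of_ereal (f y)))
    \<le> (norm (x s - y))\<^sup>2 + (\<Sum>t=s..T. \<xi> t)"
proof -
  have "(\<Sum>t=s..T. \<eta> t * (real_of_ereal (f (x t)) - real_of_ereal (f y)))
      \<le> (\<Sum>t=s..T. - ((norm (x (Suc t) - y))\<^sup>2 - (norm (x t - y))\<^sup>2) + \<xi> t)"
  proof (intro sum_mono)
    fix t assume "t \<in> {s..T}"
    then show "\<eta> t * (real_of_ereal (f (x t)) - real_of_ereal (f y))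
        \<le> - ((norm (x (Suc t) - y))\<^sup>2 - (norm (x t - y))\<^sup>2) + \<xi> t"
      using fejer_step_real[OF assms(1,2) _ _ y, of t] assms(3)[of t] \<open>1 \<le> s\<close> by auto
  qed
  also have "\<dots> = (norm (x s - y))\<^sup>2 - (norm (x (Suc T) - y))\<^sup>2 + (\<Sum>t=s..T. \<xi> t)"
    using sum_Suc_diff[of s T "\<lambda>t. (norm (x t - y))\<^sup>2"] \<open>s \<le> T\<close>
    by (simp add: sum.distrib sum_negf sum_subtractf)
  also have "\<dots> \<le> (norm (x s - y))\<^sup>2 + (\<Sum>t=s..T. \<xi> t)" by simp
  finally show ?thesis .
qed

text \<open>
  Take \<open>y = x\<^sub>s\<close> in the telescoped inequality and split
  \<open>\<eta>\<^sub>t (f(x\<^sub>t) - m) = \<eta>\<^sub>t (f(x\<^sub>t) - f(x\<^sub>s)) + \<eta>\<^sub>t (f(x\<^sub>s) - m)\<close>; the last term is at most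
  \<open>\<eta>\<^sub>s (f(x\<^sub>s) - m)\<close>. If \<open>x\<^sub>s\<close> lies outside the domain, then \<open>\<eta>\<close> vanishes from \<open>s\<close> onwards.
\<close>
lemma fejer_tail_sum_le_first_gap:
  assumes "proper f" "modified_fejer_monotone f \<eta> \<xi> x"
    and \<eta>: "\<And>t. t \<ge> 1 \<Longrightarrow> \<eta> t \<ge> 0" and \<xi>: "\<And>t. t \<ge> 1 \<Longrightarrow> \<xi> t \<ge> 0"
    and "antimono_on {1..} \<eta>"
    and lb: "\<And>y. ereal m \<le> f y"
    and "1 \<le> s" "s < T"
  shows "(\<Sum>t=Suc s..T. \<eta> t * (real_of_ereal (f (x t)) - m))
    \<le> real (T - s) * (\<eta> s * (real_of_ereal (f (x s)) - m)) + (\<Sum>t=s..T. \<xi> t)"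
proof -
  define F where "F t = real_of_ereal (f (x t))" for t
  have mono: "\<eta> t \<le> \<eta> s" if "s \<le> t" for t
    using assms(5) that \<open>1 \<le> s\<close> by (auto simp: monotone_on_def)
  show ?thesis
  proof (cases "\<eta> s = 0")
    case True
    have "\<eta> t = 0" if "t \<in> {Suc s..T}" for t
      using mono[of t] \<eta>[of t] True that by auto
    then show ?thesis
      using True \<xi> \<open>1 \<le> s\<close> by (auto intro!: sum_nonneg)
  next
    case False
    then have dom: "x s \<in> effective_domain f"
      using fejer_iterate_in_effective_domain[OF assms(1,2) \<open>1 \<le> s\<close>] \<eta>[OF \<open>1 \<le> s\<close>] by simp
    have "ereal m \<le> ereal (F s)"
      using lb[of "x s"] finite_on_effective_domain[OF assms(1) dom] by (simp add: F_def)
    then have gap: "0 \<le> F s - m" by simp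
    have "(\<Sum>t=Suc s..T. \<eta> t * (F t - m))
        \<le> (\<Sum>t=Suc s..T. \<eta> t * (F t - F s) + \<eta> s * (F s - m))"
    proof (intro sum_mono)
      fix t assume "t \<in> {Suc s..T}"
      then have "\<eta> t * (F s - m) \<le> \<eta> s * (F s - m)"
        using mono gap by (intro mult_right_mono) auto
      then show "\<eta> t * (F t - m) \<le> \<eta> t * (F t - F s) + \<eta> s * (F s - m)"
        by (simp add: algebra_simps)
    qed
    also have "\<dots> = (\<Sum>t=s..T. \<eta> t * (F t - F s)) + real (T - s) * (\<eta> s * (F s - m))"
      using \<open>s < T\<close> by (simp add: sum.distrib sum.atLeast_Suc_atMost)
    also have "\<dots> \<le> (\<Sum>t=s..T. \<xi> t) + real (T - s) * (\<eta> s * (F s - m))"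
      using fejer_telescope[OF assms(1,2) \<eta> dom \<open>1 \<le> s\<close>, of T] \<open>s < T\<close> by (simp add: F_def)
    finally show ?thesis by (simp add: F_def)
  qed
qed

text \<open>
  Comparing \<open>sqrt c\<close> with the distances covers negative \<open>c\<close> as well, because the real square root is
  odd and monotone on the whole line.
\<close>
lemma le_infdist_power2:
  assumes "S \<noteq> {}" "\<And>z. z \<in> S \<Longrightarrow> c \<le> (dist a z)\<^sup>2"
  shows "c \<le> (infdist a S)\<^sup>2"
proof -
  have "sqrt c \<le> infdist a S"
    unfolding infdist_notempty[OF assms(1)]
    using assms by (intro cINF_greatest) (auto intro: real_le_lsqrt)
  then show ?thesis by (rule sqrt_le_D)
qed

theorem theorem2p3:
  fixes f :: "'a::{real_inner, complete_space} \<Rightarrow> ereal"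
    and x :: "nat \<Rightarrow> 'a"
    and \<eta> \<xi> :: "nat \<Rightarrow> real"
    and T :: nat
  assumes "proper f"
    and "minimizers f \<noteq> {}"
    and "\<And>t. t \<ge> 1 \<Longrightarrow> \<eta> t \<ge> 0"
    and "\<And>t. t \<ge> 1 \<Longrightarrow> \<xi> t \<ge> 0"
    and "modified_fejer_monotone f \<eta> \<xi> x"
    and "antimono_on {1..} \<eta>"
    and "T > 1"
  shows "ereal (\<eta> T) * (f (x T) - min_value f)
    \<le> ereal (1 / real T * (infdist (x 1) (minimizers f))\<^sup>2
              + (\<Sum>t = 1..T - 1. 1 / real (T - t) * \<xi> t) + \<xi> T)"
proof -
  define m where "m = real_of_ereal (min_value f)"
  define v where "v t = \<eta> t * (real_of_ereal (f (x t)) - m)" for t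
  have min_le: "min_value f \<le> f y" for y
    by (simp add: min_value_def INF_lower)
  have minimizer_dom: "z \<in> effective_domain f" if "z \<in> minimizers f" for z
  proof -
    obtain y where "y \<in> effective_domain f"
      using assms(1) by (auto simp: proper_def)
    then show ?thesis
      using min_le[of y] that by (auto simp: minimizers_def effective_domain_def)
  qed
  have minimizer_value: "f z = ereal m" if "z \<in> minimizers f" for z
    using finite_on_effective_domain[OF assms(1) minimizer_dom[OF that]] that
    by (simp add: m_def minimizers_def)
  have m: "min_value f = ereal m"
  proof -
    obtain z where "z \<in> minimizers f"
      using assms(2) by blast
    with minimizer_value[OF this] show ?thesis
      by (simp add: minimizers_def)
  qed
  have "(\<Sum>t=1..T. v t - \<xi> t) \<le> (infdist (x 1) (minimizers f))\<^sup>2"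
  proof (rule le_infdist_power2[OF assms(2)])
    fix z assume z: "z \<in> minimizers f"
    show "(\<Sum>t=1..T. v t - \<xi> t) \<le> (dist (x 1) z)\<^sup>2"
      using fejer_telescope[OF assms(1,5,3) minimizer_dom[OF z], of 1 T] \<open>T > 1\<close>
      by (simp add: v_def minimizer_value[OF z] dist_norm sum_subtractf)
  qed
  then have avg: "(\<Sum>t=1..T. v t - \<xi> t) / real T \<le> 1 / real T * (infdist (x 1) (minimizers f))\<^sup>2"
    by (simp add: divide_right_mono)
  have "v T \<le> (\<Sum>t=1..T. v t - \<xi> t) / real (Suc T - 1) + (\<Sum>t=1..<T. \<xi> t / real (T - t)) + \<xi> T"
  proof (rule last_le_average)
    fix s assume "1 \<le> s" "s < T"
    then show "(\<Sum>t=Suc s..T. v t) \<le> real (T - s) * v s + (\<Sum>t=s..T. \<xi> t)"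
      unfolding v_def
      using assms min_le m by (intro fejer_tail_sum_le_first_gap) auto
  qed (use \<open>T > 1\<close> in simp)
  moreover have "(\<Sum>t=1..<T. \<xi> t / real (T - t)) = (\<Sum>t = 1..T - 1. 1 / real (T - t) * \<xi> t)"
    using \<open>T > 1\<close> by (intro sum.cong) auto
  moreover have "real (Suc T - 1) = real T" by simp
  ultimately have "v T \<le> (\<Sum>t=1..T. v t - \<xi> t) / real T
      + (\<Sum>t = 1..T - 1. 1 / real (T - t) * \<xi> t) + \<xi> T"
    by (simp only:)
  also have "\<dots> \<le> 1 / real T * (infdist (x 1) (minimizers f))\<^sup>2
      + (\<Sum>t = 1..T - 1. 1 / real (T - t) * \<xi> t) + \<xi> T"
    using avg by (intro add_right_mono)
  finally have "v T \<le> 1 / real T * (infdist (x 1) (minimizers f))\<^sup>2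
      + (\<Sum>t = 1..T - 1. 1 / real (T - t) * \<xi> t) + \<xi> T" .
  moreover have "ereal (\<eta> T) * (f (x T) - min_value f) = ereal (v T)"
  proof (cases "\<eta> T = 0")
    case False
    then have "x T \<in> effective_domain f"
      using fejer_iterate_in_effective_domain[OF assms(1,5), of T] assms(3)[of T] \<open>T > 1\<close> by simp
    from finite_on_effective_domain[OF assms(1) this] show ?thesis
      unfolding v_def m by (metis ereal_minus(1) times_ereal.simps(1))
  qed (simp add: v_def zero_ereal_def[symmetric])
  ultimately show ?thesis by simp
qed

end
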